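(* Let $\varphi\colon M\to N$ be a map of commutative monoids. (1) If $\varphi$ is local and flat, then it is injective. (2) If $\varphi$ is a local flat epimorphism, then it is an isomorphism.
   Context: "Monoid" means commutative monoid with unit; $M^\times$ is the group of invertible elements of $M$. Epimorphism means epimorphism in the category of (commutative) monoids. A map of monoids $f:M\to N$ is local if $f(M\setminus M^\times)\subset N\setminus N^\times$, i.e. $f^{-1}(N^\times)=M^\times$. For a monoid $M$, an $M$-module is a set with an action of $M$. For $M$-modules $S,T$, $S\otimes_M T$ is $S\times T$ modulo the equivalence relation generated by $(ms,t)\sim(s,mt)$. A map of monoids $M\to N$ is flat if the functor $-\otimes_M N$ from $M$-modules to $N$-modules commutes with finite limits (it always commutes with colimits). *)

theory Defs
  imports "HOL-Algebra.Group"
begin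

section \<open>Homomorphisms of commutative monoids\<close>

text \<open>The library's \<^const>\<open>hom\<close> does not ask for preservation of the unit, which is not
  automatic for monoids. (For bijections it is, so \<^const>\<open>iso\<close> needs no such change.)\<close>

definition monoid_hom :: "('a, 'r) monoid_scheme \<Rightarrow> ('b, 's) monoid_scheme \<Rightarrow> ('a \<Rightarrow> 'b) set" where
  "monoid_hom M N = {h \<in> hom M N. h \<one>\<^bsub>M\<^esub> = \<one>\<^bsub>N\<^esub>}"

definition local_hom :: "('m, 'r) monoid_scheme \<Rightarrow> ('n, 's) monoid_scheme \<Rightarrow> ('m \<Rightarrow> 'n) \<Rightarrow> bool" where
  "local_hom M N \<phi> \<longleftrightarrow>
     \<phi> \<in> monoid_hom M N \<and> \<phi> ` (carrier M - Units M) \<subseteq> carrier N - Units N"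

text \<open>Categorical epimorphisms; the library's \<^const>\<open>epi\<close> means surjective and is not used.
  The test monoids \<open>P\<close> have to range over one fixed type. The type chosen here is large enough:
  by \<open>epimorphism_cancel\<close> below, such a \<open>\<phi>\<close> is right cancellable with respect to
  commutative monoids over any type.\<close>

definition epimorphism ::
  "('m, 'r) monoid_scheme \<Rightarrow> ('n, 's) monoid_scheme \<Rightarrow> ('m \<Rightarrow> 'n) \<Rightarrow> bool" where
  "epimorphism M N \<phi> \<longleftrightarrow>
     \<phi> \<in> monoid_hom M N \<and>
     (\<forall>(P :: ('n \<times> 'n) set monoid) g h.
        comm_monoid P \<longrightarrow> g \<in> monoid_hom N P \<longrightarrow> h \<in> monoid_hom N P \<longrightarrow>
        (\<forall>x \<in> carrier M. g (\<phi> x) = h (\<phi> x)) \<longrightarrow> (\<forall>y \<in> carrier N. g y = h y))"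


section \<open>Modules over a monoid and their tensor product\<close>

record ('k, 'a) mmodule =
  points :: "'a set"
  act :: "'k \<Rightarrow> 'a \<Rightarrow> 'a"

definition is_mmodule :: "('k, 'r) monoid_scheme \<Rightarrow> ('k, 'a) mmodule \<Rightarrow> bool" where
  "is_mmodule K S \<longleftrightarrow>
     (\<forall>m \<in> carrier K. \<forall>s \<in> points S. act S m s \<in> points S) \<and>
     (\<forall>s \<in> points S. act S \<one>\<^bsub>K\<^esub> s = s) \<and>
     (\<forall>m \<in> carrier K. \<forall>m' \<in> carrier K. \<forall>s \<in> points S.
        act S (m \<otimes>\<^bsub>K\<^esub> m') s = act S m (act S m' s))"

definition mmodule_hom ::
  "('k, 'r) monoid_scheme \<Rightarrow> ('k, 'a) mmodule \<Rightarrow> ('k, 'b) mmodule \<Rightarrow> ('a \<Rightarrow> 'b) set" where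
  "mmodule_hom K S T =
     {f \<in> points S \<rightarrow> points T. \<forall>m \<in> carrier K. \<forall>s \<in> points S. f (act S m s) = act T m (f s)}"

definition mmodule_iso ::
  "('k, 'r) monoid_scheme \<Rightarrow> ('k, 'a) mmodule \<Rightarrow> ('k, 'b) mmodule \<Rightarrow> ('a \<Rightarrow> 'b) set" where
  "mmodule_iso K S T = {f \<in> mmodule_hom K S T. bij_betw f (points S) (points T)}"

definition tensor_step ::
  "('k, 'r) monoid_scheme \<Rightarrow> ('k, 'a) mmodule \<Rightarrow> ('k, 'b) mmodule \<Rightarrow> ('a \<times> 'b) rel" where
  "tensor_step K S T =
     {((act S m s, t), (s, act T m t)) | m s t. m \<in> carrier K \<and> s \<in> points S \<and> t \<in> points T}"

text \<open>The equivalence relation on \<open>S \<times> T\<close> generated by \<open>(m s, t) ~ (s, m t)\<close>; the restriction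
  only cuts the reflexive pairs down to \<open>S \<times> T\<close>.\<close>

definition tensor_rel ::
  "('k, 'r) monoid_scheme \<Rightarrow> ('k, 'a) mmodule \<Rightarrow> ('k, 'b) mmodule \<Rightarrow> ('a \<times> 'b) rel" where
  "tensor_rel K S T = Restr ((tensor_step K S T \<union> (tensor_step K S T)\<inverse>)\<^sup>*) (points S \<times> points T)"

definition tensor ::
  "('k, 'r) monoid_scheme \<Rightarrow> ('k, 'a) mmodule \<Rightarrow> ('k, 'b) mmodule \<Rightarrow> ('a \<times> 'b) set set" where
  "tensor K S T = (points S \<times> points T) // tensor_rel K S T"

definition tensor_class ::
  "('k, 'r) monoid_scheme \<Rightarrow> ('k, 'a) mmodule \<Rightarrow> ('k, 'b) mmodule \<Rightarrow> 'a \<Rightarrow> 'b \<Rightarrow> ('a \<times> 'b) set" where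
  "tensor_class K S T s t = tensor_rel K S T `` {(s, t)}"


section \<open>The functor \<open>- \<otimes>\<^sub>M N\<close>\<close>

definition scalars :: "('n, 's) monoid_scheme \<Rightarrow> ('m \<Rightarrow> 'n) \<Rightarrow> ('m, 'n) mmodule" where
  "scalars N \<phi> = \<lparr>points = carrier N, act = (\<lambda>m n. \<phi> m \<otimes>\<^bsub>N\<^esub> n)\<rparr>"

text \<open>On objects: \<open>S \<otimes>\<^sub>M N\<close> with \<open>n [s, x] = [s, n x]\<close>. On a map \<open>f : S \<rightarrow> T\<close>:
  \<open>[s, x] \<mapsto> [f s, x]\<close>. The unions run over the representatives of a class and are unions of
  equal sets, see \<open>base_change_act\<close> and \<open>base_change_map_class\<close>.\<close>

definition base_change ::
  "('m, 'r) monoid_scheme \<Rightarrow> ('n, 's) monoid_scheme \<Rightarrow> ('m \<Rightarrow> 'n) \<Rightarrow> ('m, 'a) mmodule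
     \<Rightarrow> ('n, ('a \<times> 'n) set) mmodule" where
  "base_change M N \<phi> S =
     \<lparr>points = tensor M S (scalars N \<phi>),
      act = (\<lambda>n C. \<Union>(s, x) \<in> C. tensor_class M S (scalars N \<phi>) s (n \<otimes>\<^bsub>N\<^esub> x))\<rparr>"

definition base_change_map ::
  "('m, 'r) monoid_scheme \<Rightarrow> ('n, 's) monoid_scheme \<Rightarrow> ('m \<Rightarrow> 'n) \<Rightarrow> ('m, 'b) mmodule
     \<Rightarrow> ('a \<Rightarrow> 'b) \<Rightarrow> ('a \<times> 'n) set \<Rightarrow> ('b \<times> 'n) set" where
  "base_change_map M N \<phi> T f C = (\<Union>(s, x) \<in> C. tensor_class M T (scalars N \<phi>) (f s) x)"


section \<open>Finite limits\<close>

record ('o, 'f) cat =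
  Obj :: "'o set"
  Arr :: "'f set"
  Dom :: "'f \<Rightarrow> 'o"
  Cod :: "'f \<Rightarrow> 'o"
  Idn :: "'o \<Rightarrow> 'f"
  Comp :: "'f \<Rightarrow> 'f \<Rightarrow> 'f"

definition category :: "('o, 'f) cat \<Rightarrow> bool" where
  "category J \<longleftrightarrow>
     (\<forall>f \<in> Arr J. Dom J f \<in> Obj J \<and> Cod J f \<in> Obj J) \<and>
     (\<forall>j \<in> Obj J. Idn J j \<in> Arr J \<and> Dom J (Idn J j) = j \<and> Cod J (Idn J j) = j) \<and>
     (\<forall>f \<in> Arr J. \<forall>g \<in> Arr J. Dom J g = Cod J f \<longrightarrow>
        Comp J g f \<in> Arr J \<and> Dom J (Comp J g f) = Dom J f \<and> Cod J (Comp J g f) = Cod J g) \<and>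
     (\<forall>f \<in> Arr J. Comp J f (Idn J (Dom J f)) = f \<and> Comp J (Idn J (Cod J f)) f = f) \<and>
     (\<forall>f \<in> Arr J. \<forall>g \<in> Arr J. \<forall>h \<in> Arr J. Dom J g = Cod J f \<longrightarrow> Dom J h = Cod J g \<longrightarrow>
        Comp J h (Comp J g f) = Comp J (Comp J h g) f)"

definition finite_category :: "('o, 'f) cat \<Rightarrow> bool" where
  "finite_category J \<longleftrightarrow> category J \<and> finite (Obj J) \<and> finite (Arr J)"

text \<open>Functors from \<open>J\<close> to \<open>K\<close>-modules, given by \<open>D\<close> on objects and \<open>A\<close> on arrows.\<close>

definition diagram ::
  "('k, 'r) monoid_scheme \<Rightarrow> ('o, 'f) cat \<Rightarrow> ('o \<Rightarrow> ('k, 'a) mmodule) \<Rightarrow> ('f \<Rightarrow> 'a \<Rightarrow> 'a) \<Rightarrow> bool"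
  where
  "diagram K J D A \<longleftrightarrow>
     (\<forall>j \<in> Obj J. is_mmodule K (D j)) \<and>
     (\<forall>f \<in> Arr J. A f \<in> mmodule_hom K (D (Dom J f)) (D (Cod J f))) \<and>
     (\<forall>j \<in> Obj J. \<forall>s \<in> points (D j). A (Idn J j) s = s) \<and>
     (\<forall>f \<in> Arr J. \<forall>g \<in> Arr J. Dom J g = Cod J f \<longrightarrow>
        (\<forall>s \<in> points (D (Dom J f)). A (Comp J g f) s = A g (A f s)))"

text \<open>The limit of a diagram of modules: compatible families with componentwise action. The
  projections are evaluations; see \<open>limit_universal\<close> for the universal property.\<close>

definition limit ::
  "('o, 'f) cat \<Rightarrow> ('o \<Rightarrow> ('k, 'a) mmodule) \<Rightarrow> ('f \<Rightarrow> 'a \<Rightarrow> 'a) \<Rightarrow> ('k, 'o \<Rightarrow> 'a) mmodule" where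
  "limit J D A =
     \<lparr>points = {s \<in> (\<Pi>\<^sub>E j \<in> Obj J. points (D j)). \<forall>f \<in> Arr J. A f (s (Dom J f)) = s (Cod J f)},
      act = (\<lambda>m s. \<lambda>j \<in> Obj J. act (D j) m (s j))\<rparr>"

text \<open>The canonical map \<open>(lim D) \<otimes>\<^sub>M N \<rightarrow> lim (D \<otimes>\<^sub>M N)\<close>, whose \<open>j\<close>-th component is the image
  of the projection \<open>lim D \<rightarrow> D j\<close> under the functor.\<close>

definition comparison ::
  "('m, 'r) monoid_scheme \<Rightarrow> ('n, 's) monoid_scheme \<Rightarrow> ('m \<Rightarrow> 'n) \<Rightarrow> ('o, 'f) cat
     \<Rightarrow> ('o \<Rightarrow> ('m, 'a) mmodule) \<Rightarrow> (('o \<Rightarrow> 'a) \<times> 'n) set \<Rightarrow> 'o \<Rightarrow> ('a \<times> 'n) set" where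
  "comparison M N \<phi> J D C = (\<lambda>j \<in> Obj J. base_change_map M N \<phi> (D j) (\<lambda>s. s j) C)"

definition preserves_limit ::
  "('m, 'r) monoid_scheme \<Rightarrow> ('n, 's) monoid_scheme \<Rightarrow> ('m \<Rightarrow> 'n) \<Rightarrow> ('o, 'f) cat
     \<Rightarrow> ('o \<Rightarrow> ('m, 'a) mmodule) \<Rightarrow> ('f \<Rightarrow> 'a \<Rightarrow> 'a) \<Rightarrow> bool" where
  "preserves_limit M N \<phi> J D A \<longleftrightarrow>
     comparison M N \<phi> J D \<in>
       mmodule_iso N
         (base_change M N \<phi> (limit J D A))
         (limit J (\<lambda>j. base_change M N \<phi> (D j)) (\<lambda>f. base_change_map M N \<phi> (D (Cod J f)) (A f)))"

text \<open>Finite categories are represented over \<open>nat\<close>, and the modules in the diagrams have their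
  points in the type of elements of \<open>M\<close>. Neither choice of type is a restriction: by
  \<open>flat_preserves_limit\<close> below, the limits of finite diagrams over arbitrary types are then
  preserved as well.\<close>

definition flat :: "('m, 'r) monoid_scheme \<Rightarrow> ('n, 's) monoid_scheme \<Rightarrow> ('m \<Rightarrow> 'n) \<Rightarrow> bool" where
  "flat M N \<phi> \<longleftrightarrow>
     \<phi> \<in> monoid_hom M N \<and>
     (\<forall>(J :: (nat, nat) cat) (D :: nat \<Rightarrow> ('m, 'm) mmodule) A.
        finite_category J \<longrightarrow> diagram M J D A \<longrightarrow> preserves_limit M N \<phi> J D A)"


section \<open>The constructions have the intended properties\<close>

subsection \<open>Epimorphisms\<close>

lemma epimorphism_cancel:
  fixes M :: "('m, 'r) monoid_scheme" and N :: "('n, 's) monoid_scheme"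
    and P :: "('p, 't) monoid_scheme"
  assumes "comm_monoid N" and epi: "epimorphism M N \<phi>" and "comm_monoid P"
    and g: "g \<in> monoid_hom N P" and h: "h \<in> monoid_hom N P"
    and eq: "\<And>x. x \<in> carrier M \<Longrightarrow> g (\<phi> x) = h (\<phi> x)"
    and y: "y \<in> carrier N"
  shows "g y = h y"
proof -
  interpret N: comm_monoid N by fact
  interpret P: comm_monoid P by fact
  have gc: "g a \<in> carrier P" and hc: "h a \<in> carrier P" if "a \<in> carrier N" for a
    using g h that by (auto simp: monoid_hom_def hom_def)
  have gm: "g (a \<otimes>\<^bsub>N\<^esub> b) = g a \<otimes>\<^bsub>P\<^esub> g b" and hm: "h (a \<otimes>\<^bsub>N\<^esub> b) = h a \<otimes>\<^bsub>P\<^esub> h b"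
    if "a \<in> carrier N" "b \<in> carrier N" for a b
    using g h that by (auto simp: monoid_hom_def hom_def)
  have g1: "g \<one>\<^bsub>N\<^esub> = \<one>\<^bsub>P\<^esub>" and h1: "h \<one>\<^bsub>N\<^esub> = \<one>\<^bsub>P\<^esub>"
    using g h by (auto simp: monoid_hom_def)
  define Q where "Q = {g a \<otimes>\<^bsub>P\<^esub> h b | a b. a \<in> carrier N \<and> b \<in> carrier N}"
  define e where "e q = {(a, b). a \<in> carrier N \<and> b \<in> carrier N \<and> g a \<otimes>\<^bsub>P\<^esub> h b = q}" for q
  have inj: "inj_on e Q"
  proof (rule inj_onI)
    fix p q assume "p \<in> Q" and eq: "e p = e q"
    then obtain a b where ab: "a \<in> carrier N" "b \<in> carrier N" "p = g a \<otimes>\<^bsub>P\<^esub> h b"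
      by (auto simp: Q_def)
    then have "(a, b) \<in> e q" unfolding eq[symmetric] by (simp add: e_def)
    then show "p = q" by (simp add: e_def ab)
  qed
  define d where "d = inv_into Q e"
  have de: "d (e q) = q" if "q \<in> Q" for q
    using inj that by (simp add: d_def)
  have QP: "q \<in> carrier P" if "q \<in> Q" for q
    using that gc hc by (auto simp: Q_def)
  have Qm: "p \<otimes>\<^bsub>P\<^esub> q \<in> Q" if pqQ: "p \<in> Q" "q \<in> Q" for p q
  proof -
    obtain a b a' b' where c: "a \<in> carrier N" "b \<in> carrier N" "a' \<in> carrier N" "b' \<in> carrier N"
      and pq: "p = g a \<otimes>\<^bsub>P\<^esub> h b" "q = g a' \<otimes>\<^bsub>P\<^esub> h b'"
      using pqQ unfolding Q_def by blast
    have "p \<otimes>\<^bsub>P\<^esub> q = g (a \<otimes>\<^bsub>N\<^esub> a') \<otimes>\<^bsub>P\<^esub> h (b \<otimes>\<^bsub>N\<^esub> b')"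
      using c gc hc by (simp add: pq gm hm P.m_ac)
    then show ?thesis using c by (auto simp: Q_def)
  qed
  have Qg: "g a \<in> Q" if "a \<in> carrier N" for a
  proof -
    have "g a = g a \<otimes>\<^bsub>P\<^esub> h \<one>\<^bsub>N\<^esub>" using that gc by (simp add: h1)
    then show ?thesis using that unfolding Q_def by blast
  qed
  have Qh: "h a \<in> Q" if "a \<in> carrier N" for a
  proof -
    have "h a = g \<one>\<^bsub>N\<^esub> \<otimes>\<^bsub>P\<^esub> h a" using that hc by (simp add: g1)
    then show ?thesis using that unfolding Q_def by blast
  qed
  have Q1: "\<one>\<^bsub>P\<^esub> \<in> Q" using Qg[of "\<one>\<^bsub>N\<^esub>"] by (simp add: g1)
  define R :: "('n \<times> 'n) set monoid" where
    "R = \<lparr>carrier = e ` Q, mult = (\<lambda>A B. e (d A \<otimes>\<^bsub>P\<^esub> d B)), one = e \<one>\<^bsub>P\<^esub>\<rparr>"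
  have R: "comm_monoid R"
    by (rule comm_monoidI) (auto simp: R_def de Qm Q1 QP P.m_ac)
  have G: "e \<circ> g \<in> monoid_hom N R"
    unfolding monoid_hom_def hom_def R_def by (simp add: Pi_iff imageI Qg de g1 gm)
  have H: "e \<circ> h \<in> monoid_hom N R"
    unfolding monoid_hom_def hom_def R_def by (simp add: Pi_iff imageI Qh de h1 hm)
  have "(e \<circ> g) y = (e \<circ> h) y"
  proof -
    have "\<forall>x \<in> carrier M. (e \<circ> g) (\<phi> x) = (e \<circ> h) (\<phi> x)" by (simp add: eq)
    then show ?thesis using epi R G H y unfolding epimorphism_def by blast
  qed
  then show ?thesis using inj Qg[OF y] Qh[OF y] by (auto dest: inj_onD)
qed


subsection \<open>Tensor products and base change\<close>

lemma is_mmoduleD: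
  assumes "is_mmodule K S"
  shows "m \<in> carrier K \<Longrightarrow> s \<in> points S \<Longrightarrow> act S m s \<in> points S"
    and "s \<in> points S \<Longrightarrow> act S \<one>\<^bsub>K\<^esub> s = s"
    and "m \<in> carrier K \<Longrightarrow> m' \<in> carrier K \<Longrightarrow> s \<in> points S
           \<Longrightarrow> act S (m \<otimes>\<^bsub>K\<^esub> m') s = act S m (act S m' s)"
  using assms by (auto simp: is_mmodule_def)

lemma mmodule_homD:
  assumes "f \<in> mmodule_hom K S T"
  shows "s \<in> points S \<Longrightarrow> f s \<in> points T"
    and "m \<in> carrier K \<Longrightarrow> s \<in> points S \<Longrightarrow> f (act S m s) = act T m (f s)"
  using assms by (auto simp: mmodule_hom_def)

lemma equiv_tensor_rel: "equiv (points S \<times> points T) (tensor_rel K S T)"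
proof (rule equivI)
  let ?r = "tensor_step K S T \<union> (tensor_step K S T)\<inverse>"
  have "sym ?r" by (auto simp: sym_def)
  then have "sym (?r\<^sup>*)" by (rule sym_rtrancl)
  then show "sym (tensor_rel K S T)" by (auto simp: tensor_rel_def sym_def)
  have "trans (?r\<^sup>*)" by (rule trans_rtrancl)
  then show "trans (tensor_rel K S T)"
    unfolding tensor_rel_def by (auto intro: trans_Restr)
qed (auto simp: tensor_rel_def refl_on_def)

lemma tensor_rel_step:
  assumes "m \<in> carrier K" "s \<in> points S" "t \<in> points T"
    and "act S m s \<in> points S" "act T m t \<in> points T"
  shows "((act S m s, t), (s, act T m t)) \<in> tensor_rel K S T"
  using assms unfolding tensor_rel_def tensor_step_def by blast

text \<open>\<open>tensor_rel\<close> is contained in every equivalence relation that contains the generators.\<close>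

lemma tensor_rel_least:
  assumes E: "equiv (points S \<times> points T) E"
    and S: "is_mmodule K S" and T: "is_mmodule K T"
    and gen: "\<And>m s t. m \<in> carrier K \<Longrightarrow> s \<in> points S \<Longrightarrow> t \<in> points T
                \<Longrightarrow> ((act S m s, t), (s, act T m t)) \<in> E"
  shows "tensor_rel K S T \<subseteq> E"
proof
  fix z assume z: "z \<in> tensor_rel K S T"
  obtain p q where pq: "z = (p, q)" by (cases z)
  have p: "p \<in> points S \<times> points T"
    and r: "(p, q) \<in> (tensor_step K S T \<union> (tensor_step K S T)\<inverse>)\<^sup>*"
    using z by (auto simp: tensor_rel_def pq)
  have "tensor_step K S T \<subseteq> E" using gen by (auto simp: tensor_step_def)
  then have sub: "tensor_step K S T \<union> (tensor_step K S T)\<inverse> \<subseteq> E"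
    using E by (auto simp: equiv_def sym_def)
  from r have "(p, q) \<in> E"
  proof (induction rule: rtrancl_induct)
    case base
    then show ?case using E p by (auto simp: equiv_def refl_on_def)
  next
    case (step y z)
    then show ?case using E sub by (meson equiv_def subsetD transD)
  qed
  then show "z \<in> E" by (simp add: pq)
qed

lemma tensor_class_eq_iff:
  assumes "s \<in> points S" "t \<in> points T" "s' \<in> points S" "t' \<in> points T"
  shows "tensor_class K S T s t = tensor_class K S T s' t' \<longleftrightarrow>
           ((s, t), (s', t')) \<in> tensor_rel K S T"
  unfolding tensor_class_def using assms by (intro eq_equiv_class_iff[OF equiv_tensor_rel]) auto

lemma tensor_cases:
  assumes "C \<in> tensor K S T"
  obtains s t where "s \<in> points S" "t \<in> points T" "C = tensor_class K S T s t"
  using assms unfolding tensor_def tensor_class_def by (auto elim!: quotientE)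

lemma tensor_class_in: "s \<in> points S \<Longrightarrow> t \<in> points T \<Longrightarrow> tensor_class K S T s t \<in> tensor K S T"
  unfolding tensor_def tensor_class_def by (auto intro: quotientI)

lemma tensor_class_act:
  assumes "is_mmodule K S" "is_mmodule K T" "m \<in> carrier K" "s \<in> points S" "t \<in> points T"
  shows "tensor_class K S T (act S m s) t = tensor_class K S T s (act T m t)"
  using assms by (simp add: tensor_class_eq_iff is_mmoduleD tensor_rel_step)

lemma tensor_class_Union:
  assumes S: "is_mmodule K S" and T: "is_mmodule K T"
    and st: "s \<in> points S" "t \<in> points T"
    and inv: "\<And>m s t. m \<in> carrier K \<Longrightarrow> s \<in> points S \<Longrightarrow> t \<in> points T
                \<Longrightarrow> F (act S m s) t = F s (act T m t)"
  shows "(\<Union>(s, t) \<in> tensor_class K S T s t. F s t) = F s t"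
proof -
  define E where "E = {(p, q). p \<in> points S \<times> points T \<and> q \<in> points S \<times> points T \<and>
                        F (fst p) (snd p) = F (fst q) (snd q)}"
  have "equiv (points S \<times> points T) E"
    by (rule equivI) (auto simp: E_def refl_on_def sym_def trans_def)
  then have sub: "tensor_rel K S T \<subseteq> E"
    by (rule tensor_rel_least) (use S T inv in \<open>auto simp: E_def is_mmoduleD\<close>)
  have self: "(s, t) \<in> tensor_class K S T s t"
    unfolding tensor_class_def using equiv_class_self[OF equiv_tensor_rel] st by blast
  have const: "F s' t' = F s t" if "(s', t') \<in> tensor_class K S T s t" for s' t'
  proof -
    have "((s, t), (s', t')) \<in> E" using that sub by (auto simp: tensor_class_def)
    then show ?thesis by (simp add: E_def)
  qed
  have "(\<lambda>(s', t'). F s' t') ` tensor_class K S T s t = {F s t}"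
  proof (rule equalityI)
    show "(\<lambda>(s', t'). F s' t') ` tensor_class K S T s t \<subseteq> {F s t}"
      using const by blast
    show "{F s t} \<subseteq> (\<lambda>(s', t'). F s' t') ` tensor_class K S T s t"
      using imageI[OF self, of "\<lambda>(s', t'). F s' t'"] by simp
  qed
  then show ?thesis by simp
qed

locale comm_monoid_map = M?: comm_monoid M + N?: comm_monoid N
  for M :: "('m, 'r) monoid_scheme" (structure) and N :: "('n, 's) monoid_scheme" (structure) +
  fixes \<phi> :: "'m \<Rightarrow> 'n"
  assumes map: "\<phi> \<in> monoid_hom M N"
begin

abbreviation "cls S \<equiv> tensor_class M S (scalars N \<phi>)"

lemma map_closed [simp]: "m \<in> carrier M \<Longrightarrow> \<phi> m \<in> carrier N"
  and map_mult [simp]: "m \<in> carrier M \<Longrightarrow> m' \<in> carrier M \<Longrightarrow> \<phi> (m \<otimes>\<^bsub>M\<^esub> m') = \<phi> m \<otimes>\<^bsub>N\<^esub> \<phi> m'"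
  and map_one [simp]: "\<phi> \<one>\<^bsub>M\<^esub> = \<one>\<^bsub>N\<^esub>"
  using map by (auto simp: monoid_hom_def hom_def)

lemma scalars_simps [simp]:
  "points (scalars N \<phi>) = carrier N" "act (scalars N \<phi>) m x = \<phi> m \<otimes>\<^bsub>N\<^esub> x"
  by (simp_all add: scalars_def)

lemma scalars_mmodule [simp]: "is_mmodule M (scalars N \<phi>)"
  by (auto simp: is_mmodule_def N.m_assoc)

lemma cls_act:
  assumes "is_mmodule M S" "m \<in> carrier M" "s \<in> points S" "x \<in> carrier N"
  shows "cls S (act S m s) x = cls S s (\<phi> m \<otimes>\<^bsub>N\<^esub> x)"
  using tensor_class_act[OF assms(1) scalars_mmodule, of m s x] assms by simp

lemma base_change_cases:
  assumes "C \<in> points (base_change M N \<phi> S)"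
  obtains s x where "s \<in> points S" "x \<in> carrier N" "C = cls S s x"
proof -
  have "C \<in> tensor M S (scalars N \<phi>)" using assms by (simp add: base_change_def)
  then show thesis by (rule tensor_cases) (use that in auto)
qed

lemma base_change_in:
  "s \<in> points S \<Longrightarrow> x \<in> carrier N \<Longrightarrow> cls S s x \<in> points (base_change M N \<phi> S)"
  by (simp add: base_change_def tensor_class_in)

lemma base_change_act:
  assumes S: "is_mmodule M S" and "s \<in> points S" "x \<in> carrier N" "n \<in> carrier N"
  shows "act (base_change M N \<phi> S) n (cls S s x) = cls S s (n \<otimes>\<^bsub>N\<^esub> x)"
  using assms unfolding base_change_def mmodule.simps
  by (intro tensor_class_Union) (auto simp: cls_act N.m_lcomm)

lemma base_change_map_class:
  assumes S: "is_mmodule M S" and T: "is_mmodule M T" and f: "f \<in> mmodule_hom M S T"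
    and "s \<in> points S" "x \<in> carrier N"
  shows "base_change_map M N \<phi> T f (cls S s x) = cls T (f s) x"
  using assms unfolding base_change_map_def
  by (intro tensor_class_Union) (auto simp: cls_act mmodule_homD)

lemma base_change_mmodule:
  assumes S: "is_mmodule M S"
  shows "is_mmodule N (base_change M N \<phi> S)"
  unfolding is_mmodule_def
proof (intro conjI ballI)
  fix n C assume n: "n \<in> carrier N" and "C \<in> points (base_change M N \<phi> S)"
  then obtain s x where "s \<in> points S" "x \<in> carrier N" "C = cls S s x"
    by (meson base_change_cases)
  then show "act (base_change M N \<phi> S) n C \<in> points (base_change M N \<phi> S)"
    using n by (simp add: base_change_act[OF S] base_change_in)
next
  fix C assume "C \<in> points (base_change M N \<phi> S)"
  then obtain s x where "s \<in> points S" "x \<in> carrier N" "C = cls S s x"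
    by (rule base_change_cases)
  then show "act (base_change M N \<phi> S) \<one>\<^bsub>N\<^esub> C = C"
    by (simp add: base_change_act[OF S])
next
  fix n n' C assume n: "n \<in> carrier N" "n' \<in> carrier N"
    and "C \<in> points (base_change M N \<phi> S)"
  then obtain s x where "s \<in> points S" "x \<in> carrier N" "C = cls S s x"
    by (meson base_change_cases)
  then show "act (base_change M N \<phi> S) (n \<otimes>\<^bsub>N\<^esub> n') C
      = act (base_change M N \<phi> S) n (act (base_change M N \<phi> S) n' C)"
    using n by (simp add: base_change_act[OF S] N.m_assoc)
qed

lemma base_change_map_hom:
  assumes S: "is_mmodule M S" and T: "is_mmodule M T" and f: "f \<in> mmodule_hom M S T"
  shows "base_change_map M N \<phi> T f \<in> mmodule_hom N (base_change M N \<phi> S) (base_change M N \<phi> T)"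
  unfolding mmodule_hom_def
proof (intro CollectI conjI ballI Pi_I)
  fix C assume "C \<in> points (base_change M N \<phi> S)"
  then obtain s x where "s \<in> points S" "x \<in> carrier N" "C = cls S s x"
    by (rule base_change_cases)
  then show "base_change_map M N \<phi> T f C \<in> points (base_change M N \<phi> T)"
    by (simp add: base_change_map_class[OF S T f] base_change_in mmodule_homD(1)[OF f])
next
  fix n C assume n: "n \<in> carrier N" and "C \<in> points (base_change M N \<phi> S)"
  then obtain s x where "s \<in> points S" "x \<in> carrier N" "C = cls S s x"
    by (meson base_change_cases)
  then show "base_change_map M N \<phi> T f (act (base_change M N \<phi> S) n C)
      = act (base_change M N \<phi> T) n (base_change_map M N \<phi> T f C)"
    using n by (simp add: base_change_act[OF S] base_change_act[OF T]
        base_change_map_class[OF S T f] mmodule_homD(1)[OF f])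
qed

lemma base_change_diagram:
  assumes J: "category J" and D: "diagram M J D A"
  shows "diagram N J (\<lambda>j. base_change M N \<phi> (D j)) (\<lambda>f. base_change_map M N \<phi> (D (Cod J f)) (A f))"
proof -
  have mD: "is_mmodule M (D j)" if "j \<in> Obj J" for j
    using D that by (simp add: diagram_def)
  have hA: "A f \<in> mmodule_hom M (D (Dom J f)) (D (Cod J f))" if "f \<in> Arr J" for f
    using D that by (simp add: diagram_def)
  have obj: "Dom J f \<in> Obj J" "Cod J f \<in> Obj J" if "f \<in> Arr J" for f
    using J that by (simp_all add: category_def)
  have idn: "Idn J j \<in> Arr J" "Dom J (Idn J j) = j" "Cod J (Idn J j) = j" if "j \<in> Obj J" for j
    using J that by (simp_all add: category_def)
  have cmp: "Comp J g f \<in> Arr J" "Dom J (Comp J g f) = Dom J f" "Cod J (Comp J g f) = Cod J g"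
    if "f \<in> Arr J" "g \<in> Arr J" "Dom J g = Cod J f" for f g
    using J that by (simp_all add: category_def)
  have mapA: "base_change_map M N \<phi> (D (Cod J f)) (A f) (cls (D (Dom J f)) s x)
                = cls (D (Cod J f)) (A f s) x"
    if "f \<in> Arr J" "s \<in> points (D (Dom J f))" "x \<in> carrier N" for f s x
    using that by (simp add: base_change_map_class[OF mD mD hA] obj)
  show ?thesis
    unfolding diagram_def
  proof (intro conjI ballI impI)
    fix j assume "j \<in> Obj J"
    then show "is_mmodule N (base_change M N \<phi> (D j))" by (simp add: base_change_mmodule mD)
  next
    fix f assume "f \<in> Arr J"
    then show "base_change_map M N \<phi> (D (Cod J f)) (A f)
        \<in> mmodule_hom N (base_change M N \<phi> (D (Dom J f))) (base_change M N \<phi> (D (Cod J f)))"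
      by (simp add: base_change_map_hom mD hA obj)
  next
    fix j C assume j: "j \<in> Obj J" and C: "C \<in> points (base_change M N \<phi> (D j))"
    from C obtain s x where s: "s \<in> points (D j)" "x \<in> carrier N" "C = cls (D j) s x"
      by (rule base_change_cases)
    have "A (Idn J j) s = s" using D j s by (simp add: diagram_def)
    then show "base_change_map M N \<phi> (D (Cod J (Idn J j))) (A (Idn J j)) C = C"
      using mapA[of "Idn J j" s x] s idn[OF j] by simp
  next
    fix f g C assume fg: "f \<in> Arr J" "g \<in> Arr J" "Dom J g = Cod J f"
      and C: "C \<in> points (base_change M N \<phi> (D (Dom J f)))"
    from C obtain s x where s: "s \<in> points (D (Dom J f))" "x \<in> carrier N" "C = cls (D (Dom J f)) s x"
      by (rule base_change_cases)
    have "A (Comp J g f) s = A g (A f s)" using D fg s by (simp add: diagram_def)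
    moreover have "A f s \<in> points (D (Dom J g))"
      using mmodule_homD(1)[OF hA s(1)] fg by simp
    ultimately show "base_change_map M N \<phi> (D (Cod J (Comp J g f))) (A (Comp J g f)) C
        = base_change_map M N \<phi> (D (Cod J g)) (A g) (base_change_map M N \<phi> (D (Cod J f)) (A f) C)"
      using mapA[of f s x] mapA[of g "A f s" x] mapA[of "Comp J g f" s x] s fg cmp[OF fg] by simp
  qed
qed

end


subsection \<open>Limits\<close>

lemma limit_points:
  assumes "s \<in> points (limit J D A)"
  shows "j \<in> Obj J \<Longrightarrow> s j \<in> points (D j)" and "s \<in> extensional (Obj J)"
    and "f \<in> Arr J \<Longrightarrow> A f (s (Dom J f)) = s (Cod J f)"
  using assms by (auto simp: limit_def PiE_iff)

lemma limit_act: "act (limit J D A) m s = (\<lambda>j \<in> Obj J. act (D j) m (s j))"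
  by (simp add: limit_def)

lemma limit_mmodule:
  assumes "monoid K" and J: "category J" and D: "diagram K J D A"
  shows "is_mmodule K (limit J D A)"
proof -
  interpret monoid K by fact
  have mD: "is_mmodule K (D j)" if "j \<in> Obj J" for j
    using D that by (simp add: diagram_def)
  have hA: "A f \<in> mmodule_hom K (D (Dom J f)) (D (Cod J f))" if "f \<in> Arr J" for f
    using D that by (simp add: diagram_def)
  have obj: "Dom J f \<in> Obj J" "Cod J f \<in> Obj J" if "f \<in> Arr J" for f
    using J that by (simp_all add: category_def)
  show ?thesis
    unfolding is_mmodule_def
  proof (intro conjI ballI)
    fix m s assume m: "m \<in> carrier K" and s: "s \<in> points (limit J D A)"
    show "act (limit J D A) m s \<in> points (limit J D A)"
      using m limit_points[OF s]
      by (auto simp: limit_def is_mmoduleD(1)[OF mD] obj mmodule_homD(2)[OF hA])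
  next
    fix s assume s: "s \<in> points (limit J D A)"
    show "act (limit J D A) \<one>\<^bsub>K\<^esub> s = s"
      unfolding limit_act
      by (rule extensionalityI[where A = "Obj J"])
        (use limit_points[OF s] in \<open>auto simp: is_mmoduleD(2)[OF mD]\<close>)
  next
    fix m m' s assume m: "m \<in> carrier K" "m' \<in> carrier K" and s: "s \<in> points (limit J D A)"
    show "act (limit J D A) (m \<otimes>\<^bsub>K\<^esub> m') s = act (limit J D A) m (act (limit J D A) m' s)"
      using m limit_points[OF s] by (auto simp: limit_act fun_eq_iff is_mmoduleD(3)[OF mD])
  qed
qed

lemma limit_proj:
  assumes "j \<in> Obj J"
  shows "(\<lambda>s. s j) \<in> mmodule_hom K (limit J D A) (D j)"
  using assms by (auto simp: mmodule_hom_def limit_points limit_act)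

lemma limit_universal:
  assumes "monoid K" and J: "category J" and D: "diagram K J D A" and X: "is_mmodule K X"
    and c: "\<And>j. j \<in> Obj J \<Longrightarrow> c j \<in> mmodule_hom K X (D j)"
    and cone: "\<And>f x. f \<in> Arr J \<Longrightarrow> x \<in> points X \<Longrightarrow> A f (c (Dom J f) x) = c (Cod J f) x"
  shows "\<exists>!h. h \<in> mmodule_hom K X (limit J D A) \<and> h \<in> extensional (points X) \<and>
           (\<forall>j \<in> Obj J. \<forall>x \<in> points X. h x j = c j x)"
proof (rule ex1I)
  let ?h = "\<lambda>x \<in> points X. \<lambda>j \<in> Obj J. c j x"
  have obj: "Dom J f \<in> Obj J" "Cod J f \<in> Obj J" if "f \<in> Arr J" for f
    using J that by (simp_all add: category_def)
  show "?h \<in> mmodule_hom K X (limit J D A) \<and> ?h \<in> extensional (points X) \<and>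
           (\<forall>j \<in> Obj J. \<forall>x \<in> points X. ?h x j = c j x)"
    using cone by (auto simp: mmodule_hom_def limit_def obj mmodule_homD[OF c] is_mmoduleD(1)[OF X]
        fun_eq_iff)
  fix h assume h: "h \<in> mmodule_hom K X (limit J D A) \<and> h \<in> extensional (points X) \<and>
           (\<forall>j \<in> Obj J. \<forall>x \<in> points X. h x j = c j x)"
  show "h = ?h"
  proof (rule extensionalityI[where A = "points X"])
    fix x assume x: "x \<in> points X"
    then have "h x \<in> points (limit J D A)" using h by (auto dest: mmodule_homD(1))
    then have "h x \<in> extensional (Obj J)" by (rule limit_points(2))
    then show "h x = ?h x"
      using h x by (auto intro!: extensionalityI[where A = "Obj J"])
  qed (use h in auto)
qed


subsection \<open>Flatness is independent of the choice of types\<close>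

context comm_monoid_map
begin

lemma comparison_class:
  assumes J: "category J" and D: "diagram M J D A"
    and s: "s \<in> points (limit J D A)" and x: "x \<in> carrier N"
  shows "comparison M N \<phi> J D (cls (limit J D A) s x) = (\<lambda>j \<in> Obj J. cls (D j) (s j) x)"
  unfolding comparison_def
proof (rule restrict_ext)
  fix j assume j: "j \<in> Obj J"
  have "is_mmodule M (D j)" using D j by (simp add: diagram_def)
  then show "base_change_map M N \<phi> (D j) (\<lambda>s. s j) (cls (limit J D A) s x) = cls (D j) (s j) x"
    using base_change_map_class[OF limit_mmodule[OF M.monoid_axioms J D] _ limit_proj[OF j] s x]
    by simp
qed

lemma comparison_hom:
  assumes J: "category J" and D: "diagram M J D A"
  shows "comparison M N \<phi> J D \<in>
       mmodule_hom N
         (base_change M N \<phi> (limit J D A))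
         (limit J (\<lambda>j. base_change M N \<phi> (D j)) (\<lambda>f. base_change_map M N \<phi> (D (Cod J f)) (A f)))"
    (is "_ \<in> mmodule_hom N ?L ?R")
proof -
  have mD: "is_mmodule M (D j)" if "j \<in> Obj J" for j
    using D that by (simp add: diagram_def)
  have hA: "A f \<in> mmodule_hom M (D (Dom J f)) (D (Cod J f))" if "f \<in> Arr J" for f
    using D that by (simp add: diagram_def)
  have obj: "Dom J f \<in> Obj J" "Cod J f \<in> Obj J" if "f \<in> Arr J" for f
    using J that by (simp_all add: category_def)
  note L = limit_mmodule[OF M.monoid_axioms J D]
  show ?thesis
    unfolding mmodule_hom_def
  proof (intro CollectI conjI ballI Pi_I)
    fix C assume "C \<in> points ?L"
    then obtain s x where s: "s \<in> points (limit J D A)" and x: "x \<in> carrier N"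
      and C: "C = cls (limit J D A) s x"
      by (rule base_change_cases)
    note sp = limit_points[OF s]
    have "base_change_map M N \<phi> (D (Cod J f)) (A f) (cls (D (Dom J f)) (s (Dom J f)) x)
        = cls (D (Cod J f)) (s (Cod J f)) x" if f: "f \<in> Arr J" for f
      using base_change_map_class[OF mD mD hA sp(1) x] f by (simp add: obj sp(3))
    then show "comparison M N \<phi> J D C \<in> points ?R"
      unfolding C comparison_class[OF J D s x]
      by (auto simp: limit_def obj intro: base_change_in sp x)
  next
    fix n C assume n: "n \<in> carrier N" and "C \<in> points ?L"
    then obtain s x where s: "s \<in> points (limit J D A)" and x: "x \<in> carrier N"
      and C: "C = cls (limit J D A) s x"
      by (meson base_change_cases)
    show "comparison M N \<phi> J D (act ?L n C) = act ?R n (comparison M N \<phi> J D C)"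
      using n x unfolding C
      by (auto simp: base_change_act[OF L s] comparison_class[OF J D s] limit_act
          base_change_act[OF mD] limit_points(1)[OF s] intro!: restrict_ext)
  qed
qed

definition regular :: "('m, 'm) mmodule" where
  "regular = \<lparr>points = carrier M, act = (\<lambda>m x. m \<otimes>\<^bsub>M\<^esub> x)\<rparr>"

lemma regular_simps [simp]:
  "points regular = carrier M" "act regular m x = m \<otimes>\<^bsub>M\<^esub> x"
  by (simp_all add: regular_def)

lemma regular_mmodule [simp]: "is_mmodule M regular"
  by (auto simp: is_mmodule_def M.m_assoc)

lemma cls_regular:
  assumes "a \<in> carrier M" "x \<in> carrier N"
  shows "cls regular a x = cls regular \<one>\<^bsub>M\<^esub> (\<phi> a \<otimes>\<^bsub>N\<^esub> x)"
  using cls_act[of regular a "\<one>\<^bsub>M\<^esub>" x] assms by simp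

lemma cls_regular_eqD:
  assumes eq: "cls regular a x = cls regular b y"
    and "a \<in> carrier M" "b \<in> carrier M" "x \<in> carrier N" "y \<in> carrier N"
  shows "\<phi> a \<otimes>\<^bsub>N\<^esub> x = \<phi> b \<otimes>\<^bsub>N\<^esub> y"
proof -
  have U: "(\<Union>(s, t) \<in> cls regular a x. {\<phi> s \<otimes>\<^bsub>N\<^esub> t}) = {\<phi> a \<otimes>\<^bsub>N\<^esub> x}"
    if "a \<in> carrier M" "x \<in> carrier N" for a x
    using that by (intro tensor_class_Union) (auto simp: N.m_ac)
  show ?thesis using U[of a x] U[of b y] eq assms by simp
qed

lemma preserves_limit_surj:
  assumes J: "category J" and D: "diagram M J D A" and pres: "preserves_limit M N \<phi> J D A"
    and c: "\<And>j. j \<in> Obj J \<Longrightarrow> c j \<in> points (base_change M N \<phi> (D j))"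
    and cA: "\<And>f. f \<in> Arr J \<Longrightarrow>
               base_change_map M N \<phi> (D (Cod J f)) (A f) (c (Dom J f)) = c (Cod J f)"
  obtains s x where "s \<in> points (limit J D A)" "x \<in> carrier N"
    "\<And>j. j \<in> Obj J \<Longrightarrow> cls (D j) (s j) x = c j"
proof -
  let ?R = "limit J (\<lambda>j. base_change M N \<phi> (D j)) (\<lambda>f. base_change_map M N \<phi> (D (Cod J f)) (A f))"
  have "(\<lambda>j \<in> Obj J. c j) \<in> points ?R"
    using J c cA by (auto simp: limit_def category_def)
  moreover have "comparison M N \<phi> J D ` points (base_change M N \<phi> (limit J D A)) = points ?R"
    using pres by (simp add: preserves_limit_def mmodule_iso_def bij_betw_def)
  ultimately have "(\<lambda>j \<in> Obj J. c j)
      \<in> comparison M N \<phi> J D ` points (base_change M N \<phi> (limit J D A))"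
    by simp
  then obtain C where C: "C \<in> points (base_change M N \<phi> (limit J D A))"
    and Cc: "(\<lambda>j \<in> Obj J. c j) = comparison M N \<phi> J D C"
    by (rule imageE)
  from C obtain s x where s: "s \<in> points (limit J D A)" and x: "x \<in> carrier N"
    and C': "C = cls (limit J D A) s x"
    by (rule base_change_cases)
  have "cls (D j) (s j) x = c j" if "j \<in> Obj J" for j
    using fun_cong[OF Cc, of j] that unfolding C' comparison_class[OF J D s x] by simp
  with s x show thesis by (rule that)
qed

lemma flat_common:
  assumes fl: "flat M N \<phi>" and n: "n \<in> carrier N" "n' \<in> carrier N"
  shows "\<exists>u \<in> carrier M. \<exists>v \<in> carrier M. \<exists>x \<in> carrier N. n = \<phi> u \<otimes>\<^bsub>N\<^esub> x \<and> n' = \<phi> v \<otimes>\<^bsub>N\<^esub> x"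
proof -
  define J :: "(nat, nat) cat" where
    "J = \<lparr>Obj = {0, 1}, Arr = {0, 1}, Dom = (\<lambda>f. f), Cod = (\<lambda>f. f), Idn = (\<lambda>j. j),
          Comp = (\<lambda>g f. f)\<rparr>"
  define D :: "nat \<Rightarrow> ('m, 'm) mmodule" where "D = (\<lambda>_. regular)"
  define A :: "nat \<Rightarrow> 'm \<Rightarrow> 'm" where "A = (\<lambda>_ x. x)"
  define c where "c j = cls regular \<one>\<^bsub>M\<^esub> (if j = (0::nat) then n else n')" for j
  have fJ: "finite_category J" by (auto simp: J_def finite_category_def category_def)
  then have J: "category J" by (simp add: finite_category_def)
  have idh: "(\<lambda>x. x) \<in> mmodule_hom M regular regular" by (auto simp: mmodule_hom_def)
  have dia: "diagram M J D A" by (auto simp: diagram_def D_def A_def idh)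
  have pres: "preserves_limit M N \<phi> J D A" using fl fJ dia by (simp add: flat_def)
  have c: "c j \<in> points (base_change M N \<phi> (D j))" for j
    unfolding c_def D_def by (rule base_change_in) (auto simp: n)
  have cA: "base_change_map M N \<phi> (D (Cod J f)) (A f) (c (Dom J f)) = c (Cod J f)" for f
    unfolding c_def D_def A_def
    by (subst base_change_map_class[OF _ _ idh]) (auto simp: n J_def)
  obtain s x where s: "s \<in> points (limit J D A)" and x: "x \<in> carrier N"
    and sc: "\<And>j. j \<in> Obj J \<Longrightarrow> cls (D j) (s j) x = c j"
    using preserves_limit_surj[OF J dia pres, of c] c cA by metis
  have sM: "s 0 \<in> carrier M" "s 1 \<in> carrier M"
    using limit_points(1)[OF s, of 0] limit_points(1)[OF s, of 1] by (auto simp: J_def D_def)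
  have "cls regular (s 0) x = cls regular \<one>\<^bsub>M\<^esub> n" "cls regular (s 1) x = cls regular \<one>\<^bsub>M\<^esub> n'"
    using sc[of 0] sc[of 1] by (simp_all add: J_def D_def c_def)
  then have "\<phi> (s 0) \<otimes>\<^bsub>N\<^esub> x = n" "\<phi> (s 1) \<otimes>\<^bsub>N\<^esub> x = n'"
    using cls_regular_eqD[of "s 0" x "\<one>\<^bsub>M\<^esub>" n] cls_regular_eqD[of "s 1" x "\<one>\<^bsub>M\<^esub>" n'] sM x n by auto
  with sM x show ?thesis by metis
qed

lemma flat_equalize:
  assumes fl: "flat M N \<phi>" and ab: "a \<in> carrier M" "b \<in> carrier M" and n: "n \<in> carrier N"
    and eq: "\<phi> a \<otimes>\<^bsub>N\<^esub> n = \<phi> b \<otimes>\<^bsub>N\<^esub> n"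
  shows "\<exists>u \<in> carrier M. \<exists>x \<in> carrier N. n = \<phi> u \<otimes>\<^bsub>N\<^esub> x \<and> a \<otimes>\<^bsub>M\<^esub> u = b \<otimes>\<^bsub>M\<^esub> u"
proof -
  define J :: "(nat, nat) cat" where
    "J = \<lparr>Obj = {0, 1}, Arr = {0, 1, 2, 3}, Dom = (\<lambda>f. if f = 1 then 1 else 0),
          Cod = (\<lambda>f. if f = 0 then 0 else 1), Idn = (\<lambda>j. j),
          Comp = (\<lambda>g f. if g \<le> 1 then f else g)\<rparr>"
  define D :: "nat \<Rightarrow> ('m, 'm) mmodule" where "D = (\<lambda>_. regular)"
  define k where "k f = (if f = (2::nat) then a else if f = 3 then b else \<one>\<^bsub>M\<^esub>)" for f
  define A :: "nat \<Rightarrow> 'm \<Rightarrow> 'm" where "A = (\<lambda>f x. k f \<otimes>\<^bsub>M\<^esub> x)"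
  define c where "c j = cls regular (if j = (0::nat) then \<one>\<^bsub>M\<^esub> else a) n" for j
  have fJ: "finite_category J" by (auto simp: J_def finite_category_def category_def)
  then have J: "category J" by (simp add: finite_category_def)
  have k: "k f \<in> carrier M" for f using ab by (simp add: k_def)
  have kh: "A f \<in> mmodule_hom M regular regular" for f
    using k by (auto simp: mmodule_hom_def A_def M.m_lcomm)
  have dia: "diagram M J D A"
    using kh ab by (auto simp: diagram_def D_def J_def) (auto simp: A_def k_def)
  have pres: "preserves_limit M N \<phi> J D A" using fl fJ dia by (simp add: flat_def)
  have cab: "cls regular a n = cls regular b n"
    using cls_regular[of a n] cls_regular[of b n] ab n eq by simp
  have c: "c j \<in> points (base_change M N \<phi> (D j))" for j
    unfolding c_def D_def by (rule base_change_in) (auto simp: n ab)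
  have cA: "base_change_map M N \<phi> (D (Cod J f)) (A f) (c (Dom J f)) = c (Cod J f)"
    if f: "f \<in> Arr J" for f
    unfolding c_def D_def
    by (subst base_change_map_class[OF _ _ kh])
      (use n ab f cab in \<open>auto simp: J_def A_def k_def\<close>)
  obtain s x where s: "s \<in> points (limit J D A)" and x: "x \<in> carrier N"
    and sc: "\<And>j. j \<in> Obj J \<Longrightarrow> cls (D j) (s j) x = c j"
    using preserves_limit_surj[OF J dia pres, of c] c cA by metis
  have s0: "s 0 \<in> carrier M"
    using limit_points(1)[OF s, of 0] by (auto simp: J_def D_def)
  have "a \<otimes>\<^bsub>M\<^esub> s 0 = s 1" "b \<otimes>\<^bsub>M\<^esub> s 0 = s 1"
    using limit_points(3)[OF s, of 2] limit_points(3)[OF s, of 3] by (auto simp: J_def A_def k_def)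
  moreover have "cls regular (s 0) x = cls regular \<one>\<^bsub>M\<^esub> n"
    using sc[of 0] by (simp add: J_def D_def c_def)
  then have "\<phi> (s 0) \<otimes>\<^bsub>N\<^esub> x = n"
    using cls_regular_eqD[of "s 0" x "\<one>\<^bsub>M\<^esub>" n] s0 x n by auto
  ultimately show ?thesis using s0 x by metis
qed

lemma flat_common_finite:
  assumes fl: "flat M N \<phi>" and "finite K" and "\<And>k. k \<in> K \<Longrightarrow> n k \<in> carrier N"
  shows "\<exists>x \<in> carrier N. \<exists>u. \<forall>k \<in> K. u k \<in> carrier M \<and> n k = \<phi> (u k) \<otimes>\<^bsub>N\<^esub> x"
  using assms(2,3)
proof (induction K rule: finite_induct)
  case empty
  then show ?case by auto
next
  case (insert i K)
  then obtain x u where x: "x \<in> carrier N"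
    and u: "\<And>k. k \<in> K \<Longrightarrow> u k \<in> carrier M" "\<And>k. k \<in> K \<Longrightarrow> n k = \<phi> (u k) \<otimes>\<^bsub>N\<^esub> x"
    by auto
  obtain p q y where pq: "p \<in> carrier M" "q \<in> carrier M" "y \<in> carrier N"
    and xy: "x = \<phi> p \<otimes>\<^bsub>N\<^esub> y" "n i = \<phi> q \<otimes>\<^bsub>N\<^esub> y"
    using flat_common[OF fl x, of "n i"] insert.prems by auto
  have "(if k = i then q else u k \<otimes>\<^bsub>M\<^esub> p) \<in> carrier M \<and>
      n k = \<phi> (if k = i then q else u k \<otimes>\<^bsub>M\<^esub> p) \<otimes>\<^bsub>N\<^esub> y" if "k \<in> insert i K" for k
  proof (cases "k = i")
    case True
    then show ?thesis using pq xy by simp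
  next
    case False
    then have "k \<in> K" using that by simp
    then show ?thesis using False u(1)[of k] u(2)[of k] pq xy by (simp add: N.m_assoc)
  qed
  then show ?case
    using pq(3) by (intro bexI[of _ y] exI[of _ "\<lambda>k. if k = i then q else u k \<otimes>\<^bsub>M\<^esub> p"]) auto
qed

lemma flat_cls_eqD:
  assumes fl: "flat M N \<phi>" and S: "is_mmodule M S"
    and "s \<in> points S" "s' \<in> points S" "x \<in> carrier N" "y \<in> carrier N"
    and eq: "cls S s x = cls S s' y"
  shows "\<exists>u \<in> carrier M. \<exists>v \<in> carrier M. \<exists>z \<in> carrier N.
           x = \<phi> u \<otimes>\<^bsub>N\<^esub> z \<and> y = \<phi> v \<otimes>\<^bsub>N\<^esub> z \<and> act S u s = act S v s'"
proof -
  define R where "R s x s' y \<longleftrightarrow> (\<exists>u \<in> carrier M. \<exists>v \<in> carrier M. \<exists>z \<in> carrier N.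
      x = \<phi> u \<otimes>\<^bsub>N\<^esub> z \<and> y = \<phi> v \<otimes>\<^bsub>N\<^esub> z \<and> act S u s = act S v s')" for s x s' y
  define E where "E = {((s, x), (s', y)). s \<in> points S \<and> x \<in> carrier N \<and> s' \<in> points S \<and>
      y \<in> carrier N \<and> R s x s' y}"
  have Rtrans: "R s x s'' x''" if R1: "R s x s' x'" and R2: "R s' x' s'' x''"
    and c: "s \<in> points S" "s' \<in> points S" "s'' \<in> points S" for s x s' x' s'' x''
  proof -
    obtain u v z where 1: "u \<in> carrier M" "v \<in> carrier M" "z \<in> carrier N"
      "x = \<phi> u \<otimes>\<^bsub>N\<^esub> z" "x' = \<phi> v \<otimes>\<^bsub>N\<^esub> z" "act S u s = act S v s'"
      using R1 by (auto simp: R_def)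
    obtain u' v' z' where 2: "u' \<in> carrier M" "v' \<in> carrier M" "z' \<in> carrier N"
      "x' = \<phi> u' \<otimes>\<^bsub>N\<^esub> z'" "x'' = \<phi> v' \<otimes>\<^bsub>N\<^esub> z'" "act S u' s' = act S v' s''"
      using R2 by (auto simp: R_def)
    obtain p q y where 3: "p \<in> carrier M" "q \<in> carrier M" "y \<in> carrier N"
      "z = \<phi> p \<otimes>\<^bsub>N\<^esub> y" "z' = \<phi> q \<otimes>\<^bsub>N\<^esub> y"
      using flat_common[OF fl 1(3) 2(3)] by auto
    have "\<phi> (v \<otimes>\<^bsub>M\<^esub> p) \<otimes>\<^bsub>N\<^esub> y = \<phi> (u' \<otimes>\<^bsub>M\<^esub> q) \<otimes>\<^bsub>N\<^esub> y"
      using 1 2 3 by (simp add: N.m_assoc)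
    then obtain r t where 4: "r \<in> carrier M" "t \<in> carrier N" "y = \<phi> r \<otimes>\<^bsub>N\<^esub> t"
      and vp: "(v \<otimes>\<^bsub>M\<^esub> p) \<otimes>\<^bsub>M\<^esub> r = (u' \<otimes>\<^bsub>M\<^esub> q) \<otimes>\<^bsub>M\<^esub> r"
      using flat_equalize[OF fl, of "v \<otimes>\<^bsub>M\<^esub> p" "u' \<otimes>\<^bsub>M\<^esub> q" y] 1 2 3 by auto
    define g where "g = p \<otimes>\<^bsub>M\<^esub> r"
    define h where "h = q \<otimes>\<^bsub>M\<^esub> r"
    have gh: "g \<in> carrier M" "h \<in> carrier M" "g \<otimes>\<^bsub>M\<^esub> v = h \<otimes>\<^bsub>M\<^esub> u'"
      using vp 1 2 3 4 by (simp_all add: g_def h_def M.m_ac)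
    have "act S (u \<otimes>\<^bsub>M\<^esub> g) s = act S g (act S u s)"
      using gh 1 c by (simp add: M.m_comm[of u g] is_mmoduleD(3)[OF S])
    also have "\<dots> = act S (g \<otimes>\<^bsub>M\<^esub> v) s'"
      using gh(1) 1 c by (simp add: is_mmoduleD(3)[OF S])
    also have "\<dots> = act S h (act S u' s')"
      unfolding gh(3) using gh(2) 2 c by (simp add: is_mmoduleD(3)[OF S])
    also have "\<dots> = act S (v' \<otimes>\<^bsub>M\<^esub> h) s''"
      using gh 2 c by (simp add: M.m_comm[of v' h] is_mmoduleD(3)[OF S])
    finally have "act S (u \<otimes>\<^bsub>M\<^esub> g) s = act S (v' \<otimes>\<^bsub>M\<^esub> h) s''" .
    moreover have "x = \<phi> (u \<otimes>\<^bsub>M\<^esub> g) \<otimes>\<^bsub>N\<^esub> t" "x'' = \<phi> (v' \<otimes>\<^bsub>M\<^esub> h) \<otimes>\<^bsub>N\<^esub> t"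
      using 1 2 3 4 by (simp_all add: g_def h_def N.m_assoc)
    moreover have "u \<otimes>\<^bsub>M\<^esub> g \<in> carrier M" "v' \<otimes>\<^bsub>M\<^esub> h \<in> carrier M"
      using 1 2 gh by simp_all
    ultimately show ?thesis using 4(2) unfolding R_def by blast
  qed
  have Rsym: "R s' y s x" if "R s x s' y" for s x s' y
    using that unfolding R_def by metis
  have Rgen: "R (act S m s) x s (\<phi> m \<otimes>\<^bsub>N\<^esub> x)"
    if "m \<in> carrier M" "s \<in> points S" "x \<in> carrier N" for m s x
    unfolding R_def
    by (rule bexI[of _ "\<one>\<^bsub>M\<^esub>"], rule bexI[of _ m], rule bexI[of _ x])
      (use that in \<open>auto simp: is_mmoduleD[OF S]\<close>)
  have Rrefl: "R s x s x" if "s \<in> points S" "x \<in> carrier N" for s x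
    using Rgen[of "\<one>\<^bsub>M\<^esub>" s x] that by (simp add: is_mmoduleD[OF S])
  have "equiv (points S \<times> points (scalars N \<phi>)) E"
  proof (rule equivI)
    show "refl_on (points S \<times> points (scalars N \<phi>)) E"
      by (auto simp: refl_on_def E_def Rrefl)
    show "E \<subseteq> (points S \<times> points (scalars N \<phi>)) \<times> (points S \<times> points (scalars N \<phi>))"
      by (auto simp: E_def)
    show "sym E" by (auto simp: sym_def E_def Rsym)
    show "trans E"
      unfolding trans_def E_def by (auto intro: Rtrans)
  qed
  then have "tensor_rel M S (scalars N \<phi>) \<subseteq> E"
    by (rule tensor_rel_least) (use S in \<open>auto simp: E_def Rgen is_mmoduleD\<close>)
  moreover have "((s, x), (s', y)) \<in> tensor_rel M S (scalars N \<phi>)"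
    using eq assms tensor_class_eq_iff[of s S x "scalars N \<phi>" s' y M] by simp
  ultimately show ?thesis unfolding E_def R_def by blast
qed

lemma flat_equalize_finite:
  assumes fl: "flat M N \<phi>" and "finite K" and x: "x \<in> carrier N"
    and "\<And>k. k \<in> K \<Longrightarrow> is_mmodule M (T k)"
    and "\<And>k. k \<in> K \<Longrightarrow> a k \<in> points (T k)" "\<And>k. k \<in> K \<Longrightarrow> b k \<in> points (T k)"
    and "\<And>k. k \<in> K \<Longrightarrow> cls (T k) (a k) x = cls (T k) (b k) x"
  shows "\<exists>w \<in> carrier M. \<exists>z \<in> carrier N. x = \<phi> w \<otimes>\<^bsub>N\<^esub> z \<and>
           (\<forall>k \<in> K. act (T k) w (a k) = act (T k) w (b k))"
  using assms(2,4-)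
proof (induction K rule: finite_induct)
  case empty
  have "x = \<phi> \<one>\<^bsub>M\<^esub> \<otimes>\<^bsub>N\<^esub> x" using x by simp
  then show ?case using x by blast
next
  case (insert i K)
  have T: "is_mmodule M (T k)" and ak: "a k \<in> points (T k)" and bk: "b k \<in> points (T k)"
    if "k \<in> insert i K" for k
    using insert.prems that by auto
  have "\<exists>w \<in> carrier M. \<exists>z \<in> carrier N. x = \<phi> w \<otimes>\<^bsub>N\<^esub> z \<and>
          (\<forall>k \<in> K. act (T k) w (a k) = act (T k) w (b k))"
    by (rule insert.IH) (use insert.prems in auto)
  then obtain w z where w: "w \<in> carrier M" "z \<in> carrier N" "x = \<phi> w \<otimes>\<^bsub>N\<^esub> z"
    and wK: "\<And>k. k \<in> K \<Longrightarrow> act (T k) w (a k) = act (T k) w (b k)"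
    by blast
  obtain u v y where u: "u \<in> carrier M" "v \<in> carrier M" "y \<in> carrier N"
      "x = \<phi> u \<otimes>\<^bsub>N\<^esub> y" "x = \<phi> v \<otimes>\<^bsub>N\<^esub> y" "act (T i) u (a i) = act (T i) v (b i)"
    using flat_cls_eqD[OF fl T[of i] ak bk x x] insert.prems(4)[of i] by auto
  obtain r t where r: "r \<in> carrier M" "t \<in> carrier N" "y = \<phi> r \<otimes>\<^bsub>N\<^esub> t"
      and uv: "u \<otimes>\<^bsub>M\<^esub> r = v \<otimes>\<^bsub>M\<^esub> r"
    using flat_equalize[OF fl u(1,2,3)] u by auto
  define w' where "w' = u \<otimes>\<^bsub>M\<^esub> r"
  have w': "w' \<in> carrier M" "x = \<phi> w' \<otimes>\<^bsub>N\<^esub> t"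
    using u r by (simp_all add: w'_def N.m_assoc)
  have "act (T i) w' (a i) = act (T i) r (act (T i) u (a i))"
    using u r ak[of i] by (simp add: w'_def M.m_comm[of u r] is_mmoduleD(3)[OF T])
  also have "\<dots> = act (T i) (v \<otimes>\<^bsub>M\<^esub> r) (b i)"
    using u r bk[of i] by (simp add: M.m_comm[of v r] is_mmoduleD(3)[OF T])
  finally have w'i: "act (T i) w' (a i) = act (T i) w' (b i)" by (simp add: w'_def uv)
  obtain p q c where p: "p \<in> carrier M" "q \<in> carrier M" "c \<in> carrier N"
      "z = \<phi> p \<otimes>\<^bsub>N\<^esub> c" "t = \<phi> q \<otimes>\<^bsub>N\<^esub> c"
    using flat_common[OF fl w(2) r(2)] by auto
  have "\<phi> (w \<otimes>\<^bsub>M\<^esub> p) \<otimes>\<^bsub>N\<^esub> c = \<phi> (w' \<otimes>\<^bsub>M\<^esub> q) \<otimes>\<^bsub>N\<^esub> c"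
    using w w' p by (simp add: N.m_assoc)
  then obtain d e where d: "d \<in> carrier M" "e \<in> carrier N" "c = \<phi> d \<otimes>\<^bsub>N\<^esub> e"
      and wd: "(w \<otimes>\<^bsub>M\<^esub> p) \<otimes>\<^bsub>M\<^esub> d = (w' \<otimes>\<^bsub>M\<^esub> q) \<otimes>\<^bsub>M\<^esub> d"
    using flat_equalize[OF fl, of "w \<otimes>\<^bsub>M\<^esub> p" "w' \<otimes>\<^bsub>M\<^esub> q" c] w w' p by auto
  define g where "g = p \<otimes>\<^bsub>M\<^esub> d"
  define h where "h = q \<otimes>\<^bsub>M\<^esub> d"
  have g: "g \<in> carrier M" "h \<in> carrier M" and gh: "g \<otimes>\<^bsub>M\<^esub> w = h \<otimes>\<^bsub>M\<^esub> w'"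
    using wd p d w w' by (simp_all add: g_def h_def M.m_ac)
  have "act (T k) (g \<otimes>\<^bsub>M\<^esub> w) (a k) = act (T k) (g \<otimes>\<^bsub>M\<^esub> w) (b k)" if k: "k \<in> insert i K" for k
  proof (cases "k = i")
    case True
    then show ?thesis
      unfolding gh using g w' w'i ak[OF k] bk[OF k] by (simp add: is_mmoduleD(3)[OF T])
  next
    case False
    then show ?thesis
      using k wK[of k] g w ak[OF k] bk[OF k] by (simp add: is_mmoduleD(3)[OF T[OF k]])
  qed
  moreover have "x = \<phi> (g \<otimes>\<^bsub>M\<^esub> w) \<otimes>\<^bsub>N\<^esub> e"
    using w p d by (simp add: g_def M.m_ac N.m_ac)
  moreover have "g \<otimes>\<^bsub>M\<^esub> w \<in> carrier M" using g w by simp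
  ultimately show ?case using d(2) by blast
qed

theorem flat_preserves_limit:
  fixes J :: "('o, 'f) cat" and D :: "'o \<Rightarrow> ('m, 'a) mmodule"
  assumes fl: "flat M N \<phi>" and fJ: "finite_category J" and D: "diagram M J D A"
  shows "preserves_limit M N \<phi> J D A"
proof -
  let ?L = "limit J D A"
  let ?R = "limit J (\<lambda>j. base_change M N \<phi> (D j)) (\<lambda>f. base_change_map M N \<phi> (D (Cod J f)) (A f))"
  let ?cmp = "comparison M N \<phi> J D"
  have J: "category J" and fin: "finite (Obj J)" "finite (Arr J)"
    using fJ by (auto simp: finite_category_def)
  have mD: "is_mmodule M (D j)" if "j \<in> Obj J" for j
    using D that by (simp add: diagram_def)
  have hA: "A f \<in> mmodule_hom M (D (Dom J f)) (D (Cod J f))" if "f \<in> Arr J" for f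
    using D that by (simp add: diagram_def)
  have obj: "Dom J f \<in> Obj J" "Cod J f \<in> Obj J" if "f \<in> Arr J" for f
    using J that by (simp_all add: category_def)
  note L = limit_mmodule[OF M.monoid_axioms J D]
  have cmp: "?cmp \<in> mmodule_hom N (base_change M N \<phi> ?L) ?R"
    by (rule comparison_hom[OF J D])
  have "inj_on ?cmp (points (base_change M N \<phi> ?L))"
  proof (rule inj_onI)
    fix C C' assume "C \<in> points (base_change M N \<phi> ?L)" "C' \<in> points (base_change M N \<phi> ?L)"
      and eq: "?cmp C = ?cmp C'"
    then obtain s n s' n' where s: "s \<in> points ?L" and n: "n \<in> carrier N" and C: "C = cls ?L s n"
      and s': "s' \<in> points ?L" and n': "n' \<in> carrier N" and C': "C' = cls ?L s' n'"
      by (meson base_change_cases)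
    obtain p q x where p: "p \<in> carrier M" "q \<in> carrier M" and x: "x \<in> carrier N"
      and nx: "n = \<phi> p \<otimes>\<^bsub>N\<^esub> x" "n' = \<phi> q \<otimes>\<^bsub>N\<^esub> x"
      using flat_common[OF fl n n'] by auto
    define t where "t = act ?L p s"
    define t' where "t' = act ?L q s'"
    have t: "t \<in> points ?L" "t' \<in> points ?L"
      using is_mmoduleD(1)[OF L] p s s' by (auto simp: t_def t'_def)
    have Ct: "C = cls ?L t x" "C' = cls ?L t' x"
      using cls_act[OF L p(1) s x] cls_act[OF L p(2) s' x] by (simp_all add: C C' t_def t'_def nx)
    have "cls (D j) (t j) x = cls (D j) (t' j) x" if "j \<in> Obj J" for j
      using fun_cong[OF eq, of j] that
      unfolding Ct comparison_class[OF J D t(1) x] comparison_class[OF J D t(2) x] by simp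
    then obtain w z where w: "w \<in> carrier M" "z \<in> carrier N" "x = \<phi> w \<otimes>\<^bsub>N\<^esub> z"
      and wt: "\<And>j. j \<in> Obj J \<Longrightarrow> act (D j) w (t j) = act (D j) w (t' j)"
      using flat_equalize_finite[OF fl fin(1) x, of D t t'] mD limit_points(1)[OF t(1)]
        limit_points(1)[OF t(2)] by blast
    have "act ?L w t = act ?L w t'"
      unfolding limit_act by (rule restrict_ext) (rule wt)
    then show "C = C'"
      using cls_act[OF L w(1) t(1) w(2)] cls_act[OF L w(1) t(2) w(2)] by (simp add: Ct w(3))
  qed
  moreover have "points ?R \<subseteq> ?cmp ` points (base_change M N \<phi> ?L)"
  proof
    fix c assume c: "c \<in> points ?R"
    have "\<forall>j \<in> Obj J. \<exists>s n. s \<in> points (D j) \<and> n \<in> carrier N \<and> c j = cls (D j) s n"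
      using limit_points(1)[OF c] by (meson base_change_cases)
    then obtain s n where s: "\<And>j. j \<in> Obj J \<Longrightarrow> s j \<in> points (D j)"
      and n: "\<And>j. j \<in> Obj J \<Longrightarrow> n j \<in> carrier N"
      and cs: "\<And>j. j \<in> Obj J \<Longrightarrow> c j = cls (D j) (s j) (n j)"
      by metis
    obtain x u where x: "x \<in> carrier N" and u: "\<And>j. j \<in> Obj J \<Longrightarrow> u j \<in> carrier M"
      and nu: "\<And>j. j \<in> Obj J \<Longrightarrow> n j = \<phi> (u j) \<otimes>\<^bsub>N\<^esub> x"
      using flat_common_finite[OF fl fin(1), of n] n by metis
    define t where "t j = act (D j) (u j) (s j)" for j
    have t: "t j \<in> points (D j)" if "j \<in> Obj J" for j
      using is_mmoduleD(1)[OF mD] that u s by (simp add: t_def)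
    have ct: "c j = cls (D j) (t j) x" if "j \<in> Obj J" for j
      using cls_act[OF mD u s x] that by (simp add: cs nu t_def)
    have At: "A f (t (Dom J f)) \<in> points (D (Cod J f))" if "f \<in> Arr J" for f
      using mmodule_homD(1)[OF hA[OF that]] t obj that by simp
    have "cls (D (Cod J f)) (A f (t (Dom J f))) x = cls (D (Cod J f)) (t (Cod J f)) x"
      if f: "f \<in> Arr J" for f
      using limit_points(3)[OF c f] base_change_map_class[OF mD mD hA t x] f
      by (simp add: ct obj)
    then obtain w z where w: "w \<in> carrier M" "z \<in> carrier N" "x = \<phi> w \<otimes>\<^bsub>N\<^esub> z"
      and wt: "\<And>f. f \<in> Arr J \<Longrightarrow>
        act (D (Cod J f)) w (A f (t (Dom J f))) = act (D (Cod J f)) w (t (Cod J f))"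
      using flat_equalize_finite[OF fl fin(2) x, of "\<lambda>f. D (Cod J f)" "\<lambda>f. A f (t (Dom J f))"
          "\<lambda>f. t (Cod J f)"] mD obj t At by blast
    define r where "r = (\<lambda>j \<in> Obj J. act (D j) w (t j))"
    have "A f (r (Dom J f)) = r (Cod J f)" if f: "f \<in> Arr J" for f
      using mmodule_homD(2)[OF hA[OF f] w(1) t] wt[OF f] f by (simp add: r_def obj)
    then have r: "r \<in> points ?L"
      using is_mmoduleD(1)[OF mD] w t by (auto simp: limit_def r_def)
    have "?cmp (cls ?L r z) = c"
    proof (rule extensionalityI[where A = "Obj J"])
      show "c \<in> extensional (Obj J)" using limit_points(2)[OF c] .
      fix j assume j: "j \<in> Obj J"
      then show "?cmp (cls ?L r z) j = c j"
        unfolding comparison_class[OF J D r w(2)]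
        using cls_act[OF mD[OF j] w(1) t[OF j] w(2)] by (simp add: ct r_def w(3))
    qed (simp add: comparison_def)
    then show "c \<in> ?cmp ` points (base_change M N \<phi> ?L)"
      using base_change_in[OF r w(2)] by (metis imageI)
  qed
  ultimately show ?thesis
    using cmp mmodule_homD(1)[OF cmp]
    unfolding preserves_limit_def mmodule_iso_def bij_betw_def by blast
qed

end

end

theory Submission
  imports Defs
begin

text \<open>
  Flatness lifts equations from \<open>N\<close> and from tensor products to \<open>M\<close>: if
  \<open>\<phi> a \<cdot> n = \<phi> b \<cdot> n\<close>, then \<open>n = \<phi> u z\<close> for some \<open>u\<close>, \<open>z\<close> with \<open>a u = b u\<close>
  (\<open>flat_equalize\<close>), and if \<open>s \<otimes> x = s' \<otimes> y\<close> in \<open>S \<otimes>\<^sub>M N\<close>, then \<open>x = \<phi> u z\<close> and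
  \<open>y = \<phi> v z\<close> with \<open>u s = v s'\<close> (\<open>flat_cls_eqD\<close>). When the decomposed element of \<open>N\<close> is
  the unit, \<open>1 = \<phi> u z\<close> says that \<open>\<phi> u\<close> is invertible, so locality makes \<open>u\<close> invertible
  in \<open>M\<close>, and \<open>u\<close> can be cancelled. The same holds for \<open>v\<close> in the tensor criterion with
  \<open>y = 1\<close>.

  For injectivity this is applied to \<open>\<phi> a \<cdot> 1 = \<phi> b \<cdot> 1\<close>.

  For surjectivity one uses that \<open>N \<otimes>\<^sub>M N\<close> is the pushout of \<open>\<phi>\<close> with itself in commutative
  monoids, so an epimorphism satisfies \<open>n \<otimes> 1 = 1 \<otimes> n\<close> for every \<open>n\<close> in \<open>N\<close>. The
  tensor criterion turns this into \<open>1 = \<phi> v z\<close> and \<open>\<phi> u = \<phi> v n\<close>, hence \<open>n = \<phi> (v\<^sup>-\<^sup>1 u)\<close>.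
\<close>

context comm_monoid_map
begin

lemma local_hom_Units:
  assumes "local_hom M N \<phi>" and "u \<in> carrier M" and "z \<in> carrier N"
    and "\<one>\<^bsub>N\<^esub> = \<phi> u \<otimes>\<^bsub>N\<^esub> z"
  shows "u \<in> Units M"
proof -
  have "\<phi> u \<in> Units N"
    using assms(2-) by (auto simp: Units_def N.m_comm intro!: bexI[of _ z])
  then show ?thesis using assms(1,2) by (auto simp: local_hom_def)
qed

lemma local_flat_inj:
  assumes loc: "local_hom M N \<phi>" and fl: "flat M N \<phi>"
  shows "inj_on \<phi> (carrier M)"
proof (rule inj_onI)
  fix a b assume ab: "a \<in> carrier M" "b \<in> carrier M" and "\<phi> a = \<phi> b"
  then obtain u x where u: "u \<in> carrier M" and x: "x \<in> carrier N" "\<one>\<^bsub>N\<^esub> = \<phi> u \<otimes>\<^bsub>N\<^esub> x"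
    and au: "a \<otimes>\<^bsub>M\<^esub> u = b \<otimes>\<^bsub>M\<^esub> u"
    using flat_equalize[OF fl ab, of "\<one>\<^bsub>N\<^esub>"] by auto
  have "u \<in> Units M" using loc u x by (rule local_hom_Units)
  then show "a = b" using au ab u M.Units_l_cancel[of u a b] by (simp add: M.m_comm)
qed

abbreviation pure_tensor :: "'n \<Rightarrow> 'n \<Rightarrow> ('n \<times> 'n) set" where
  "pure_tensor \<equiv> cls (scalars N \<phi>)"

text \<open>The pushout of \<open>\<phi>\<close> along itself: \<open>N \<otimes>\<^sub>M N\<close> with
  \<open>(s \<otimes> x) (t \<otimes> y) = s t \<otimes> x y\<close>. The unions run over representatives and are unions of
  equal sets.\<close>

definition tensor_square :: "('n \<times> 'n) set monoid" where
  "tensor_square =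
     \<lparr>carrier = tensor M (scalars N \<phi>) (scalars N \<phi>),
      mult = (\<lambda>C D. \<Union>(s, x) \<in> C. \<Union>(t, y) \<in> D. pure_tensor (s \<otimes>\<^bsub>N\<^esub> t) (x \<otimes>\<^bsub>N\<^esub> y)),
      one = pure_tensor \<one>\<^bsub>N\<^esub> \<one>\<^bsub>N\<^esub>\<rparr>"

lemma pure_tensor_balanced:
  assumes "m \<in> carrier M" "s \<in> carrier N" "x \<in> carrier N"
  shows "pure_tensor (\<phi> m \<otimes>\<^bsub>N\<^esub> s) x = pure_tensor s (\<phi> m \<otimes>\<^bsub>N\<^esub> x)"
  using cls_act[of "scalars N \<phi>" m s x] assms by simp

lemma pure_tensor_mult:
  assumes "s \<in> carrier N" "x \<in> carrier N" "t \<in> carrier N" "y \<in> carrier N"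
  shows "pure_tensor s x \<otimes>\<^bsub>tensor_square\<^esub> pure_tensor t y
           = pure_tensor (s \<otimes>\<^bsub>N\<^esub> t) (x \<otimes>\<^bsub>N\<^esub> y)"
proof -
  have inner: "(\<Union>(t, y) \<in> pure_tensor t y. pure_tensor (s \<otimes>\<^bsub>N\<^esub> t) (x \<otimes>\<^bsub>N\<^esub> y))
      = pure_tensor (s \<otimes>\<^bsub>N\<^esub> t) (x \<otimes>\<^bsub>N\<^esub> y)" if "s \<in> carrier N" "x \<in> carrier N" for s x
  proof (rule tensor_class_Union)
    fix m t y assume "m \<in> carrier M" "t \<in> points (scalars N \<phi>)" "y \<in> points (scalars N \<phi>)"
    then show "pure_tensor (s \<otimes>\<^bsub>N\<^esub> act (scalars N \<phi>) m t) (x \<otimes>\<^bsub>N\<^esub> y)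
        = pure_tensor (s \<otimes>\<^bsub>N\<^esub> t) (x \<otimes>\<^bsub>N\<^esub> act (scalars N \<phi>) m y)"
      using that pure_tensor_balanced[of m "s \<otimes>\<^bsub>N\<^esub> t" "x \<otimes>\<^bsub>N\<^esub> y"] by (simp add: N.m_lcomm)
  qed (use assms in auto)
  have "pure_tensor s x \<otimes>\<^bsub>tensor_square\<^esub> pure_tensor t y
      = (\<Union>(s, x) \<in> pure_tensor s x. \<Union>(t, y) \<in> pure_tensor t y.
           pure_tensor (s \<otimes>\<^bsub>N\<^esub> t) (x \<otimes>\<^bsub>N\<^esub> y))"
    by (simp add: tensor_square_def)
  also have "\<dots> = (\<Union>(t, y) \<in> pure_tensor t y. pure_tensor (s \<otimes>\<^bsub>N\<^esub> t) (x \<otimes>\<^bsub>N\<^esub> y))"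
  proof (rule tensor_class_Union)
    fix m s x assume "m \<in> carrier M" "s \<in> points (scalars N \<phi>)" "x \<in> points (scalars N \<phi>)"
    then show "(\<Union>(t, y) \<in> pure_tensor t y.
          pure_tensor (act (scalars N \<phi>) m s \<otimes>\<^bsub>N\<^esub> t) (x \<otimes>\<^bsub>N\<^esub> y))
        = (\<Union>(t, y) \<in> pure_tensor t y.
          pure_tensor (s \<otimes>\<^bsub>N\<^esub> t) (act (scalars N \<phi>) m x \<otimes>\<^bsub>N\<^esub> y))"
      using assms pure_tensor_balanced[of m "s \<otimes>\<^bsub>N\<^esub> t" "x \<otimes>\<^bsub>N\<^esub> y"]
      by (simp add: inner N.m_assoc)
  qed (use assms in auto)
  finally show ?thesis using assms by (simp add: inner)
qed

lemma pure_tensor_cases: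
  assumes "C \<in> carrier tensor_square"
  obtains s x where "s \<in> carrier N" "x \<in> carrier N" "C = pure_tensor s x"
proof -
  have "C \<in> tensor M (scalars N \<phi>) (scalars N \<phi>)" using assms by (simp add: tensor_square_def)
  then show thesis by (rule tensor_cases) (use that in auto)
qed

lemma pure_tensor_in:
  "s \<in> carrier N \<Longrightarrow> x \<in> carrier N \<Longrightarrow> pure_tensor s x \<in> carrier tensor_square"
  by (simp add: tensor_square_def tensor_class_in)

lemma tensor_square_one: "\<one>\<^bsub>tensor_square\<^esub> = pure_tensor \<one>\<^bsub>N\<^esub> \<one>\<^bsub>N\<^esub>"
  by (simp add: tensor_square_def)

lemma tensor_square_comm_monoid: "comm_monoid tensor_square"
  by (rule comm_monoidI)
    (auto simp: pure_tensor_mult pure_tensor_in tensor_square_one N.m_ac elim!: pure_tensor_cases)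

text \<open>The two inclusions of \<open>N\<close> into \<open>N \<otimes>\<^sub>M N\<close> agree on the image of \<open>\<phi>\<close>, because
  \<open>\<phi> m \<otimes> 1 = 1 \<otimes> \<phi> m\<close>; an epimorphism therefore cannot tell them apart.\<close>

lemma epimorphism_pure_tensor:
  assumes epi: "epimorphism M N \<phi>" and n: "n \<in> carrier N"
  shows "pure_tensor n \<one>\<^bsub>N\<^esub> = pure_tensor \<one>\<^bsub>N\<^esub> n"
proof (rule epimorphism_cancel[OF N.comm_monoid_axioms epi tensor_square_comm_monoid _ _ _ n])
  show "(\<lambda>n. pure_tensor n \<one>\<^bsub>N\<^esub>) \<in> monoid_hom N tensor_square"
    by (auto simp: monoid_hom_def hom_def pure_tensor_mult pure_tensor_in tensor_square_one)
  show "pure_tensor \<one>\<^bsub>N\<^esub> \<in> monoid_hom N tensor_square"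
    by (auto simp: monoid_hom_def hom_def pure_tensor_mult pure_tensor_in tensor_square_one)
  show "pure_tensor (\<phi> m) \<one>\<^bsub>N\<^esub> = pure_tensor \<one>\<^bsub>N\<^esub> (\<phi> m)" if "m \<in> carrier M" for m
    using that pure_tensor_balanced[of m "\<one>\<^bsub>N\<^esub>" "\<one>\<^bsub>N\<^esub>"] by simp
qed

lemma local_flat_epimorphism_surj:
  assumes loc: "local_hom M N \<phi>" and fl: "flat M N \<phi>" and epi: "epimorphism M N \<phi>"
  shows "carrier N \<subseteq> \<phi> ` carrier M"
proof
  fix n assume n: "n \<in> carrier N"
  obtain u v z where uvz: "u \<in> carrier M" "v \<in> carrier M" "z \<in> carrier N"
    and z: "\<one>\<^bsub>N\<^esub> = \<phi> v \<otimes>\<^bsub>N\<^esub> z" and uv: "\<phi> u = \<phi> v \<otimes>\<^bsub>N\<^esub> n"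
    using flat_cls_eqD[OF fl scalars_mmodule, of "\<one>\<^bsub>N\<^esub>" n n "\<one>\<^bsub>N\<^esub>"]
      epimorphism_pure_tensor[OF epi n] n by auto
  have v: "v \<in> Units M" using loc uvz(2,3) z by (rule local_hom_Units)
  have "n = \<phi> (inv\<^bsub>M\<^esub> v \<otimes>\<^bsub>M\<^esub> v) \<otimes>\<^bsub>N\<^esub> n" using v n by (simp add: M.Units_l_inv)
  also have "\<dots> = \<phi> (inv\<^bsub>M\<^esub> v) \<otimes>\<^bsub>N\<^esub> \<phi> u"
    unfolding uv using v uvz(2) n by (simp add: N.m_assoc del: M.Units_l_inv)
  also have "\<dots> = \<phi> (inv\<^bsub>M\<^esub> v \<otimes>\<^bsub>M\<^esub> u)" using v uvz(1) by simp
  finally show "n \<in> \<phi> ` carrier M" using v uvz by blast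
qed

end

theorem proposition29:
  fixes M :: "'m monoid" and N :: "'n monoid" and \<phi> :: "'m \<Rightarrow> 'n"
  assumes "comm_monoid M" and "comm_monoid N" and "\<phi> \<in> monoid_hom M N"
  shows "(local_hom M N \<phi> \<and> flat M N \<phi> \<longrightarrow> inj_on \<phi> (carrier M)) \<and>
         (local_hom M N \<phi> \<and> flat M N \<phi> \<and> epimorphism M N \<phi> \<longrightarrow> \<phi> \<in> iso M N)"
proof -
  interpret comm_monoid_map M N \<phi>
    using assms by (simp add: comm_monoid_map_def comm_monoid_map_axioms_def)
  have "\<phi> \<in> hom M N" "\<phi> ` carrier M \<subseteq> carrier N"
    using assms(3) by (auto simp: monoid_hom_def hom_def)
  then show ?thesis
    using local_flat_inj local_flat_epimorphism_surj by (auto simp: iso_def bij_betw_def)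
qed

end
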